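(* For each $\alpha>1$, $\lim_{r\to0^{+}}m_{r}(\alpha)=w(\alpha)$.
   Context: For real $r>0$: $g(1,r)=\prod_p\left(1+\frac{r}{p-1}\right)\left(1-\frac1p\right)^{r}$ (product over all primes), $\Gamma$ is the Gamma function, $m_r(\alpha)=\frac{g(1,r)}{\Gamma(r)}\left(\alpha^{r-1}+(1-r)\alpha^{r-1}\int_1^\alpha \frac{du}{u^{r}(u-1)^{1-r}}\right)$ for $1\le\alpha\le2$, and $m_r(\alpha)=2^{1-r}m_r(2)\alpha^{r-1}+(1-r)\alpha^{r-1}\int_2^\alpha \frac{m_r(u-1)}{u^{r}}\,du$ for $\alpha>2$. $w$ is the Buchstab function: the continuous function on $[1,\infty)$ with $w(\alpha)=1/\alpha$ for $1\le\alpha\le2$ and $\frac{d}{d\alpha}(\alpha w(\alpha))=w(\alpha-1)$ for $\alpha>2$. *)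

theory Defs
  imports "HOL-Analysis.Analysis" "HOL-Computational_Algebra.Primes"
begin

text \<open>
  \<open>g1 r\<close> is the value $g(1,r)$. The product over the primes is written as an infinite product over the
  naturals in which every index that is not prime contributes the factor 1.
\<close>

definition g1 :: "real \<Rightarrow> real" where
  "g1 r = (\<Prod>p. if prime p then (1 + r / (real p - 1)) * (1 - 1 / real p) powr r else 1)"

lemma integral_fundef_cong [fundef_cong]:
  fixes f g :: "'a :: euclidean_space \<Rightarrow> 'b :: real_normed_vector"
  assumes "S = T" "\<And>x. x \<in> T \<Longrightarrow> f x = g x"
  shows "integral S f = integral T g"
  using assms integral_cong by blast

text \<open>
  The recursion for \<open>\<alpha> > 2\<close> only uses values of \<open>m r\<close> in \<open>[1, \<alpha> - 1] \<union> {2}\<close>.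
  Outside the intended domain \<open>\<alpha> \<ge> 1\<close> the value is set to 0. In the first integral the integrand
  is singular (but integrable for \<open>r > 0\<close>) at the endpoint \<open>u = 1\<close>; the value 0
  that HOL assigns to it there is irrelevant.
\<close>

function m :: "real \<Rightarrow> real \<Rightarrow> real" where
  "m r \<alpha> =
    (if \<alpha> < 1 then 0
     else if \<alpha> \<le> 2 then
       g1 r / Gamma r *
         (\<alpha> powr (r - 1) +
          (1 - r) * \<alpha> powr (r - 1) *
            integral {1..\<alpha>} (\<lambda>u. 1 / (u powr r * (u - 1) powr (1 - r))))
     else
       2 powr (1 - r) * m r 2 * \<alpha> powr (r - 1) +
       (1 - r) * \<alpha> powr (r - 1) * integral {2..\<alpha>} (\<lambda>u. m r (u - 1) / u powr r))"
  by pat_completeness auto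
termination
  by (relation "Wellfounded.measure (\<lambda>(r, \<alpha>). nat \<lceil>\<alpha>\<rceil>)") (auto, linarith+)

declare m.simps [simp del]

text \<open>
  Values below 1 are normalised to 0 so that the function is determined uniquely as a total function.
\<close>

definition is_buchstab :: "(real \<Rightarrow> real) \<Rightarrow> bool" where
  "is_buchstab w \<longleftrightarrow>
     continuous_on {1..} w \<and>
     (\<forall>\<alpha>\<in>{1..2}. w \<alpha> = 1 / \<alpha>) \<and>
     (\<forall>\<alpha>>2. ((\<lambda>x. x * w x) has_real_derivative w (\<alpha> - 1)) (at \<alpha>)) \<and>
     (\<forall>\<alpha><1. w \<alpha> = 0)"

definition buchstab :: "real \<Rightarrow> real" where
  "buchstab = (THE w. is_buchstab w)"

text \<open>
  Existence and uniqueness, so that the description operator above denotes the Buchstab function.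
\<close>

function bfun :: "real \<Rightarrow> real" where
  "bfun \<alpha> = (if \<alpha> < 1 then 0 else if \<alpha> \<le> 2 then 1 / \<alpha> else (1 + integral {2..\<alpha>} (\<lambda>u. bfun (u - 1))) / \<alpha>)"
  by pat_completeness auto
termination by (relation "Wellfounded.measure (\<lambda>\<alpha>. nat \<lceil>\<alpha>\<rceil>)") (auto, linarith+)
declare bfun.simps [simp del]

lemma bfun_eq: "\<alpha> \<ge> 2 \<Longrightarrow> bfun \<alpha> = (1 + integral {2..\<alpha>} (\<lambda>u. bfun (u - 1))) / \<alpha>"
  by (subst bfun.simps) (auto simp: bfun.simps[of 2])

lemma bfun_cont_aux: "continuous_on {1..2 + real n} bfun"
proof (induction n)
  case 0
  have "continuous_on {1..2::real} (\<lambda>\<alpha>. 1 / \<alpha>)" by (intro continuous_intros) auto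
  then show ?case
    by (rule continuous_on_cong[THEN iffD1, rotated -1]) (auto simp: bfun.simps)
next
  case (Suc n)
  have c: "continuous_on {2..2 + real (Suc n)} (\<lambda>u. bfun (u - 1))"
    by (rule continuous_on_compose2[OF Suc.IH]) (auto intro!: continuous_intros)
  have "continuous_on {2..2 + real (Suc n)} (\<lambda>\<alpha>. (1 + integral {2..\<alpha>} (\<lambda>u. bfun (u - 1))) / \<alpha>)"
    by (intro continuous_intros indefinite_integral_continuous_1 integrable_continuous_interval c) auto
  then have 1: "continuous_on {2..2 + real (Suc n)} bfun"
    by (rule continuous_on_cong[THEN iffD1, rotated -1]) (auto simp: bfun_eq)
  have 2: "continuous_on {1..2} bfun"
    by (rule continuous_on_subset[OF Suc.IH]) auto
  have "{1..2 + real (Suc n)} = {1..2} \<union> {2..2 + real (Suc n)}" by auto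
  then show ?case
    using continuous_on_closed_Un[OF _ _ 2 1] by simp
qed

lemma is_buchstab_bfun: "is_buchstab bfun"
proof -
  have cont: "continuous_on {1..b} bfun" for b
  proof -
    obtain n where "b \<le> real n" using real_arch_simple by blast
    then show ?thesis by (intro continuous_on_subset[OF bfun_cont_aux[of n]]) auto
  qed
  have "isCont (\<lambda>x. bfun (max 1 x)) x" for x
  proof -
    have "continuous_on {..<x + 1} (\<lambda>x. bfun (max 1 x))"
      by (rule continuous_on_compose2[OF cont[of "max 1 (x+1)"]]) (auto intro!: continuous_intros)
    then show ?thesis by (simp add: continuous_on_eq_continuous_at)
  qed
  then have "continuous_on {1..} (\<lambda>x. bfun (max 1 x))"
    by (simp add: continuous_at_imp_continuous_on)
  then have 1: "continuous_on {1..} bfun"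
    by (rule continuous_on_cong[THEN iffD1, rotated -1]) (auto simp: max_def)
  have "((\<lambda>x. x * bfun x) has_real_derivative bfun (\<alpha> - 1)) (at \<alpha>)" if "\<alpha> > 2" for \<alpha>
  proof -
    have c: "continuous_on {2..\<alpha> + 1} (\<lambda>u. bfun (u - 1))"
      by (rule continuous_on_compose2[OF cont[of \<alpha>]]) (auto intro!: continuous_intros)
    have "((\<lambda>x. integral {2..x} (\<lambda>u. bfun (u - 1))) has_real_derivative bfun (\<alpha> - 1)) (at \<alpha> within {2..\<alpha> + 1})"
      using integral_has_real_derivative[OF c, of \<alpha>] that by simp
    then have "((\<lambda>x. 1 + integral {2..x} (\<lambda>u. bfun (u - 1))) has_real_derivative bfun (\<alpha> - 1)) (at \<alpha>)"
      using that by (auto simp: at_within_Icc_at intro!: derivative_eq_intros)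
    then show ?thesis
      by (rule has_field_derivative_transform_within_open[of _ _ _ "{2<..}"])
        (use that in \<open>auto simp: bfun_eq\<close>)
  qed
  then show ?thesis unfolding is_buchstab_def using 1 by (auto simp: bfun.simps)
qed

lemma is_buchstab_unique:
  assumes v: "is_buchstab v" and w: "is_buchstab w"
  shows "v = w"
proof -
  have eq: "\<forall>x\<le>2 + real n. v x = w x" for n
  proof (induction n)
    case 0
    have "v x = w x" if "x \<le> 2" for x
      using v w that by (cases "x < 1") (auto simp: is_buchstab_def)
    then show ?case by simp
  next
    case (Suc n)
    have "v x = w x" if x: "2 < x" "x \<le> 2 + real (Suc n)" for x
    proof -
      let ?d = "\<lambda>x. x * v x - x * w x"
      have "continuous_on {2..x} v" "continuous_on {2..x} w"
        using v w by (auto simp: is_buchstab_def intro: continuous_on_subset)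
      then have "continuous_on {2..x} ?d"
        by (intro continuous_intros)
      moreover have "(?d has_real_derivative 0) (at y)" if y: "2 < y" "y < x" for y
      proof -
        have "(?d has_real_derivative v (y - 1) - w (y - 1)) (at y)"
          using v w y by (auto simp: is_buchstab_def intro!: DERIV_diff)
        moreover have "v (y - 1) = w (y - 1)" using Suc.IH x y by auto
        ultimately show ?thesis by simp
      qed
      ultimately have "?d x = ?d 2"
        by (intro DERIV_isconst_end) (use x in auto)
      then show ?thesis
        using Suc.IH x by simp
    qed
    then show ?case using Suc.IH by (metis le_less_linear order_trans of_nat_0_le_iff le_add_same_cancel1)
  qed
  show ?thesis
  proof
    fix x
    obtain n where "x \<le> real n" using real_arch_simple by blast
    then show "v x = w x" using eq[of n] by auto
  qed
qed

lemma is_buchstab_buchstab: "is_buchstab buchstab"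
  unfolding buchstab_def
  by (rule theI[of is_buchstab, OF is_buchstab_bfun]) (rule is_buchstab_unique[OF _ is_buchstab_bfun])

end

theory Submission
  imports Defs
begin

text \<open>
  For \<open>r \<rightarrow> 0\<^sup>+\<close> the logarithm of the Euler factor of \<open>g1 r\<close> at \<open>p\<close> is at most \<open>r / (p - 1)\<^sup>2\<close> in
  absolute value, whence \<open>g1 r \<rightarrow> 1\<close>. Since \<open>1 / Gamma r = r / Gamma (1 + r)\<close>, the factor
  \<open>g1 r / Gamma r\<close> cancels the singularity of the integral of \<open>(u - 1) powr (r - 1)\<close>, which gives
  the limit \<open>1 / \<alpha>\<close> on \<open>{1<..2}\<close> and a bound uniform in \<open>r\<close>. This bound propagates through the recursion,
  so that dominated convergence carries the limit from \<open>{1<..2 + n}\<close> to \<open>{1<..3 + n}\<close>. The limit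
  fails at \<open>\<alpha> = 1\<close>, where \<open>m r 1 \<rightarrow> 0\<close>, so the integrals must be taken over open intervals.
\<close>

text \<open>In a first countable space a limit along \<open>at a within T\<close> can be tested on
  sequences, which reduces the claim to the sequential dominated convergence theorem. The domination
  holds only eventually in \<open>r\<close>, so each test sequence is shifted past the index
  \<open>N\<close> from which it applies.\<close>

lemma dominated_convergence_at_within:
  fixes f :: "'a :: first_countable_topology \<Rightarrow> 'n :: euclidean_space \<Rightarrow> 'm :: euclidean_space"
  assumes bd: "\<forall>\<^sub>F r in at a within T. f r integrable_on S \<and> (\<forall>x\<in>S. norm (f r x) \<le> h x)"
    and h: "h integrable_on S"
    and lim: "\<And>x. x \<in> S \<Longrightarrow> ((\<lambda>r. f r x) \<longlongrightarrow> g x) (at a within T)"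
  shows "((\<lambda>r. integral S (f r)) \<longlongrightarrow> integral S g) (at a within T)"
  unfolding tendsto_at_iff_sequentially
proof (intro allI impI)
  fix X assume X: "\<forall>i. X i \<in> T - {a}" "X \<longlonglongrightarrow> a"
  have fX: "filterlim X (at a within T) sequentially"
    using X by (auto simp: filterlim_at)
  from eventually_compose_filterlim[OF bd fX] obtain N where
    N: "\<And>k. k \<ge> N \<Longrightarrow> f (X k) integrable_on S \<and> (\<forall>x\<in>S. norm (f (X k) x) \<le> h x)"
    by (auto simp: eventually_sequentially)
  have "(\<lambda>k. integral S (f (X (k + N)))) \<longlonglongrightarrow> integral S g"
  proof (rule dominated_convergence(2)[where h = h])
    fix x assume "x \<in> S"
    from filterlim_compose[OF lim[OF this] fX] show "(\<lambda>k. f (X (k + N)) x) \<longlonglongrightarrow> g x"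
      by (rule LIMSEQ_ignore_initial_segment)
  qed (use N h in auto)
  then show "((\<lambda>r. integral S (f r)) \<circ> X) \<longlonglongrightarrow> integral S g"
    unfolding o_def by (rule LIMSEQ_offset)
qed

section \<open>The Euler product near \<open>r = 0\<close>\<close>

lemma euler_factor_eq_exp:
  fixes r :: real
  assumes "prime p" "0 < r"
  shows "(1 + r / (real p - 1)) * (1 - 1 / real p) powr r =
           exp (ln (1 + r / (real p - 1)) - r * ln (1 + 1 / (real p - 1)))"
proof -
  have p: "real p \<ge> 2" using prime_ge_2_nat[OF assms(1)] by simp
  \<comment> \<open>Both factors become functions of \<open>1 / (real p - 1)\<close>, so that their
    first-order terms will cancel.\<close>
  have "1 - 1 / real p = inverse (1 + 1 / (real p - 1))"
    using p by (simp add: field_simps)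
  then have "ln (1 - 1 / real p) = - ln (1 + 1 / (real p - 1))"
    using p by (simp add: ln_inverse)
  moreover have "1 + r / (real p - 1) > 0" using p assms by (simp add: add_pos_nonneg)
  moreover have "1 - 1 / real p > 0" using p by simp
  ultimately show ?thesis
    using p by (simp add: powr_def exp_diff exp_minus field_simps)
qed

text \<open>For \<open>t\<close> in [0, 1], \<open>ln (1 + t)\<close> lies between
  \<open>t - t\<^sup>2\<close> and \<open>t\<close>. With \<open>t = r * y\<close> and
  \<open>t = y\<close> the terms \<open>r * y\<close> cancel and only quadratic errors remain.
  Keeping the factor \<open>r\<close> makes the sum over the primes vanish in the limit.\<close>

lemma abs_ln_diff_le:
  fixes r y :: real
  assumes "0 < r" "r \<le> 1" "0 \<le> y" "y \<le> 1"
  shows "\<bar>ln (1 + r * y) - r * ln (1 + y)\<bar> \<le> r * y\<^sup>2"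
proof -
  have ry: "0 \<le> r * y" "r * y \<le> 1" using assms by (auto intro: mult_le_one)
  have "r * y - (r * y)\<^sup>2 \<le> ln (1 + r * y)" "ln (1 + r * y) \<le> r * y"
    using ry by (auto intro: ln_one_plus_pos_lower_bound ln_add_one_self_le_self)
  moreover have "r * (y - y\<^sup>2) \<le> r * ln (1 + y)" "r * ln (1 + y) \<le> r * y"
    using assms by (auto intro!: mult_left_mono ln_one_plus_pos_lower_bound ln_add_one_self_le_self)
  moreover have "(r * y)\<^sup>2 \<le> r * y\<^sup>2"
  proof -
    have "r\<^sup>2 * y\<^sup>2 \<le> r * y\<^sup>2" using assms by (intro mult_right_mono) (auto simp: power2_eq_square)
    then show ?thesis by (simp add: power_mult_distrib)
  qed
  ultimately show ?thesis by (simp add: algebra_simps abs_le_iff)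
qed

lemma g1_tendsto_1: "(g1 \<longlongrightarrow> 1) (at_right 0)"
proof -
  define a where "a r p = (if prime p then ln (1 + r / (real p - 1)) - r * ln (1 + 1 / (real p - 1)) else 0)"
    for r :: real and p :: nat
  define b where "b p = 1 / (real p - 1)\<^sup>2" for p :: nat
  \<comment> \<open>The shift skips the indices 0 and 1, where \<open>b\<close> is 1 and (by
    division by zero) 0; what remains is the series of inverse squares of the positive
    integers.\<close>
  have "summable (\<lambda>p. b (p + 2))"
  proof -
    have "summable (\<lambda>n. inverse (real (Suc n) ^ 2))"
      by (subst summable_Suc_iff) (rule inverse_power_summable, simp)
    then show ?thesis by (simp add: b_def field_simps)
  qed
  then have b: "summable b" by (simp only: summable_iff_shift)
  have ab: "\<bar>a r p\<bar> \<le> r * b p" if "0 < r" "r \<le> 1" for r p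
  proof (cases "prime p")
    case True
    then have "real p \<ge> 2" using prime_ge_2_nat by fastforce
    then show ?thesis
      using abs_ln_diff_le[of r "1 / (real p - 1)"] that True
      by (simp add: a_def b_def power_divide)
  qed (use that in \<open>auto simp: a_def b_def\<close>)
  have sa: "summable (a r)" if "0 < r" "r \<le> 1" for r
    by (rule summable_comparison_test'[of "\<lambda>p. r * b p"]) (use b ab[OF that] in \<open>auto intro: summable_mult\<close>)
  have eq: "g1 r = exp (suminf (a r))" if "0 < r" "r \<le> 1" for r
  proof -
    have "g1 r = (\<Prod>p. exp (a r p))"
      unfolding g1_def by (intro arg_cong[where f = prodinf] ext) (simp add: a_def euler_factor_eq_exp that)
    then show ?thesis using prodinf_exp[OF sa[OF that]] by simp
  qed
  have bd: "\<bar>suminf (a r)\<bar> \<le> r * suminf b" if "0 < r" "r \<le> 1" for r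
  proof -
    have s: "summable (\<lambda>p. \<bar>a r p\<bar>)"
      by (rule summable_comparison_test'[of "\<lambda>p. r * b p"]) (use b ab[OF that] in \<open>auto intro: summable_mult\<close>)
    have "\<bar>suminf (a r)\<bar> \<le> (\<Sum>p. \<bar>a r p\<bar>)"
      by (rule summable_rabs[OF s])
    also have "\<dots> \<le> (\<Sum>p. r * b p)"
      by (intro suminf_le s ab that summable_mult b)
    finally show ?thesis using suminf_mult[OF b, of r] by simp
  qed
  have ev: "\<forall>\<^sub>F r in at_right (0::real). 0 < r \<and> r \<le> 1"
    unfolding eventually_at_right_field by (rule exI[of _ 1]) auto
  have "((\<lambda>r. suminf (a r)) \<longlongrightarrow> 0) (at_right 0)"
  proof (rule tendsto_0_le[where K = 1])
    show "((\<lambda>r. r * suminf b) \<longlongrightarrow> 0) (at_right 0)"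
      by (auto intro!: tendsto_eq_intros)
    show "\<forall>\<^sub>F r in at_right 0. norm (suminf (a r)) \<le> norm (r * suminf b) * 1"
      using ev by eventually_elim (use bd in force)
  qed
  from tendsto_exp[OF this] have "((\<lambda>r. exp (suminf (a r))) \<longlongrightarrow> 1) (at_right 0)" by simp
  then show ?thesis
    by (rule Lim_transform_eventually) (use ev in \<open>eventually_elim, simp add: eq\<close>)
qed

lemma g1_div_Gamma_plus1_tendsto_1: "((\<lambda>r. g1 r / Gamma (1 + r)) \<longlongrightarrow> 1) (at_right 0)"
proof -
  have "((\<lambda>r::real. Gamma (1 + r)) \<longlongrightarrow> Gamma (1 + 0)) (at_right 0)"
    by (intro tendsto_Gamma tendsto_intros) (auto elim!: nonpos_Ints_cases)
  from tendsto_divide[OF g1_tendsto_1 this] show ?thesis by simp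
qed

section \<open>The singular integral\<close>

definition kernel :: "real \<Rightarrow> real \<Rightarrow> real" where
  "kernel r u = 1 / (u powr r * (u - 1) powr (1 - r))"

lemma kernel_eq: "kernel r u = u powr (-r) * (u - 1) powr (r - 1)"
  using powr_minus_divide[of u r] powr_minus_divide[of "u - 1" "1 - r"] by (simp add: kernel_def)

lemma has_integral_shifted_powr:
  fixes r \<alpha> :: real
  assumes "r > 0" "\<alpha> \<ge> 1"
  shows "((\<lambda>u. (u - 1) powr (r - 1)) has_integral ((\<alpha> - 1) powr r / r)) {1..\<alpha>}"
proof -
  have "((\<lambda>x. x powr (r - 1)) has_integral ((\<alpha> - 1) powr r / r)) (cbox 0 (\<alpha> - 1))"
    using has_integral_powr_from_0[of "r - 1" "\<alpha> - 1"] assms by simp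
  from has_integral_affinity[OF this, of 1 "-1"] show ?thesis
    by simp
qed

text \<open>On [1, \<alpha>] the factor \<open>u powr (-r)\<close> decreases from 1 to
  \<open>\<alpha> powr (-r)\<close>, so the kernel is squeezed between multiples of a power with an
  explicit integral. At \<open>u = 1\<close> all terms are 0, as
  \<open>0 powr x = 0\<close>.\<close>

lemma kernel_bounds:
  assumes "0 < r" "1 \<le> u" "u \<le> \<alpha>"
  shows "0 \<le> kernel r u" "kernel r u \<le> (u - 1) powr (r - 1)"
    "\<alpha> powr (-r) * (u - 1) powr (r - 1) \<le> kernel r u"
proof -
  have "u powr (-r) \<le> 1" "\<alpha> powr (-r) \<le> u powr (-r)"
    using assms powr_mono2'[of "-r" 1 u] powr_mono2'[of "-r" u \<alpha>] by auto
  then show "0 \<le> kernel r u" "kernel r u \<le> (u - 1) powr (r - 1)"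
    "\<alpha> powr (-r) * (u - 1) powr (r - 1) \<le> kernel r u"
    by (auto simp: kernel_eq mult_left_le_one_le intro!: mult_right_mono)
qed

text \<open>For \<open>r < 1\<close> the kernel is unbounded near 1, so integrability comes from
  measurability and domination rather than from continuity.\<close>

lemma kernel_integrable:
  assumes "0 < r" "1 \<le> \<alpha>"
  shows "kernel r integrable_on {1..\<alpha>}"
proof (rule measurable_bounded_by_integrable_imp_integrable_real)
  have "kernel r \<in> borel_measurable borel"
    unfolding kernel_def[abs_def] by measurable
  then show "kernel r \<in> borel_measurable (lebesgue_on {1..\<alpha>})"
    by (intro measurable_restrict_space1 measurable_completion) simp
  show "(\<lambda>u. (u - 1) powr (r - 1)) integrable_on {1..\<alpha>}"
    using has_integral_shifted_powr[OF assms] by blast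
qed (use kernel_bounds[OF assms(1)] in \<open>auto simp: abs_of_nonneg\<close>)

text \<open>For \<open>\<alpha> > 1\<close> both outer bounds on \<open>r\<close> times the integral
  tend to 1 as \<open>r\<close> tends to 0 from the right; at \<open>\<alpha> = 1\<close> they are
  0.\<close>

lemma kernel_integral_bounds:
  assumes "0 < r" "1 \<le> \<alpha>"
  shows "0 \<le> integral {1..\<alpha>} (kernel r)"
    "r * integral {1..\<alpha>} (kernel r) \<le> (\<alpha> - 1) powr r"
    "\<alpha> powr (-r) * (\<alpha> - 1) powr r \<le> r * integral {1..\<alpha>} (kernel r)"
proof -
  note I = has_integral_shifted_powr[OF assms]
  note K = integrable_integral[OF kernel_integrable[OF assms]]
  show "0 \<le> integral {1..\<alpha>} (kernel r)"
    by (rule integral_nonneg) (use kernel_integrable[OF assms] kernel_bounds[OF assms(1)] in auto)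
  have "integral {1..\<alpha>} (kernel r) \<le> (\<alpha> - 1) powr r / r"
    by (rule has_integral_le[OF K I]) (use kernel_bounds[OF assms(1)] in auto)
  then show "r * integral {1..\<alpha>} (kernel r) \<le> (\<alpha> - 1) powr r"
    using assms by (simp add: field_simps)
  have "\<alpha> powr (-r) * ((\<alpha> - 1) powr r / r) \<le> integral {1..\<alpha>} (kernel r)"
    by (rule has_integral_le[OF has_integral_mult_right[OF I] K]) (use kernel_bounds[OF assms(1)] in auto)
  then show "\<alpha> powr (-r) * (\<alpha> - 1) powr r \<le> r * integral {1..\<alpha>} (kernel r)"
    using assms by (simp add: field_simps)
qed

section \<open>Working forms of \<open>m\<close> and its continuity\<close>

lemma m_initial:
  assumes "0 < r" "1 \<le> \<alpha>" "\<alpha> \<le> 2"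
  shows "m r \<alpha> = g1 r / Gamma (1 + r) *
           (\<alpha> powr (r - 1) * (r + (1 - r) * (r * integral {1..\<alpha>} (kernel r))))"
proof -
  have "Gamma (1 + r) = r * Gamma r" "Gamma r > 0"
    using Gamma_plus1[of r] Gamma_real_pos[of r] assms by (auto simp: add.commute nonpos_Ints_def)
  moreover have "g / G * (p + (1 - r) * p * I) = g / (r * G) * (p * (r + (1 - r) * (r * I)))"
    if "G > 0" for g G p I :: real
    using assms that by (simp add: divide_simps) (simp add: algebra_simps)
  ultimately show ?thesis
    using assms by (simp add: m.simps[of r \<alpha>] kernel_def[abs_def])
qed

text \<open>Including \<open>\<alpha> = 2\<close>, where the integral vanishes and the powers of 2
  cancel, lets the two branches be glued along closed intervals.\<close>

lemma m_recursion:
  assumes "2 \<le> \<alpha>"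
  shows "m r \<alpha> = 2 powr (1 - r) * m r 2 * \<alpha> powr (r - 1) +
           (1 - r) * \<alpha> powr (r - 1) * integral {2..\<alpha>} (\<lambda>u. m r (u - 1) / u powr r)"
proof (cases "\<alpha> = 2")
  case True
  have "2 powr (1 - r) * (2::real) powr (r - 1) = 1" by (simp flip: powr_add)
  with True show ?thesis by simp
qed (use assms in \<open>simp add: m.simps[of r \<alpha>]\<close>)

text \<open>Continuity is what makes the integrand of the recursion integrable. The recursion looks
  back by one unit, so each induction step extends the interval by one.\<close>

lemma m_continuous_on:
  assumes r: "0 < r"
  shows "continuous_on {1..2 + real n} (m r)"
proof (induction n)
  case 0
  have "continuous_on {1..2} (\<lambda>\<alpha>. g1 r / Gamma (1 + r) *
      (\<alpha> powr (r - 1) * (r + (1 - r) * (r * integral {1..\<alpha>} (kernel r)))))"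
    by (intro continuous_intros indefinite_integral_continuous_1 kernel_integrable r) auto
  then show ?case
    by (rule continuous_on_cong[THEN iffD1, rotated -1]) (use r in \<open>auto simp: m_initial\<close>)
next
  case (Suc n)
  have "continuous_on {2..2 + real (Suc n)} (\<lambda>u. m r (u - 1))"
    by (rule continuous_on_compose2[OF Suc.IH]) (auto intro!: continuous_intros)
  then have c: "continuous_on {2..2 + real (Suc n)} (\<lambda>u. m r (u - 1) / u powr r)"
    by (intro continuous_intros) auto
  have "continuous_on {2..2 + real (Suc n)} (\<lambda>\<alpha>. 2 powr (1 - r) * m r 2 * \<alpha> powr (r - 1) +
           (1 - r) * \<alpha> powr (r - 1) * integral {2..\<alpha>} (\<lambda>u. m r (u - 1) / u powr r))"
    by (intro continuous_intros indefinite_integral_continuous_1 integrable_continuous_interval c) auto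
  then have 1: "continuous_on {2..2 + real (Suc n)} (m r)"
    by (rule continuous_on_cong[THEN iffD1, rotated -1]) (auto simp: m_recursion[symmetric])
  have 2: "continuous_on {1..2} (m r)"
    by (rule continuous_on_subset[OF Suc.IH]) auto
  have "{1..2 + real (Suc n)} = {1..2} \<union> {2..2 + real (Suc n)}" by auto
  then show ?case
    using continuous_on_closed_Un[OF _ _ 2 1] by simp
qed

lemma m_integrand_integrable:
  assumes "0 < r"
  shows "(\<lambda>u. m r (u - 1) / u powr r) integrable_on {2..\<alpha>}"
proof -
  obtain n where n: "\<alpha> \<le> real n" using real_arch_simple by blast
  have "continuous_on {2..\<alpha>} (\<lambda>u. m r (u - 1))"
    by (rule continuous_on_compose2[OF m_continuous_on[OF assms, of n]])
      (use n in \<open>auto intro!: continuous_intros\<close>)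
  then show ?thesis
    by (intro integrable_continuous_interval continuous_intros) auto
qed

section \<open>Bounds uniform in \<open>r\<close>\<close>

lemma abs_divide_powr_le:
  fixes x u r :: real
  assumes "\<bar>x\<bar> \<le> B" "1 \<le> u" "0 \<le> r"
  shows "\<bar>x / u powr r\<bar> \<le> B"
proof -
  have "\<bar>x\<bar> / u powr r \<le> \<bar>x\<bar> / 1"
    using assms by (intro divide_left_mono) (auto simp: ge_one_powr_ge_zero)
  then show ?thesis using assms by simp
qed

lemma eventually_at_right_0_unit: "\<forall>\<^sub>F r in at_right (0::real). 0 < r \<and> r < 1"
  unfolding eventually_at_right_field by (rule exI[of _ 1]) auto

text \<open>\<open>B\<close> may depend on \<open>n\<close> but not on \<open>r\<close> or \<alpha>,
  so the constant function \<open>B\<close> can serve as the dominating function.\<close>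

lemma m_eventually_bounded:
  "\<exists>B. \<forall>\<^sub>F r in at_right 0. \<forall>\<alpha>\<in>{1..2 + real n}. \<bar>m r \<alpha>\<bar> \<le> B"
proof (induction n)
  case 0
  have "\<forall>\<^sub>F r in at_right 0. g1 r / Gamma (1 + r) < 2"
    "\<forall>\<^sub>F r in at_right 0. g1 r / Gamma (1 + r) > 0"
    using order_tendstoD[OF g1_div_Gamma_plus1_tendsto_1] by auto
  then have "\<forall>\<^sub>F r in at_right 0. \<forall>\<alpha>\<in>{1..2}. \<bar>m r \<alpha>\<bar> \<le> 2"
    using eventually_at_right_0_unit
  proof eventually_elim
    case (elim r)
    show ?case
    proof
      fix \<alpha> :: real assume \<alpha>: "\<alpha> \<in> {1..2}"
      let ?J = "r * integral {1..\<alpha>} (kernel r)"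
      note J = kernel_integral_bounds[of r \<alpha>]
      \<comment> \<open>Hence \<open>r + (1 - r) * ?J\<close> is a convex combination of 1 and
        \<open>?J\<close> and lies in [0, 1]; the bound 2 then comes from the prefactor
        alone.\<close>
      have "?J \<le> 1" "0 \<le> ?J"
        using J \<alpha> elim powr_le1[of r "\<alpha> - 1"] by auto
      then have "0 \<le> (1 - r) * ?J" "(1 - r) * ?J \<le> 1 - r"
        using elim by (auto simp del: zero_le_mult_iff intro: mult_nonneg_nonneg mult_left_le)
      then have "0 \<le> r + (1 - r) * ?J" "r + (1 - r) * ?J \<le> 1"
        using elim by linarith+
      moreover have "0 \<le> \<alpha> powr (r - 1)" "\<alpha> powr (r - 1) \<le> 1"
        using \<alpha> elim powr_mono2'[of "r - 1" 1 \<alpha>] by auto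
      ultimately have "0 \<le> \<alpha> powr (r - 1) * (r + (1 - r) * ?J)" "\<alpha> powr (r - 1) * (r + (1 - r) * ?J) \<le> 1"
        by (auto intro: mult_le_one)
      then have "\<bar>g1 r / Gamma (1 + r) * (\<alpha> powr (r - 1) * (r + (1 - r) * ?J))\<bar> \<le> 2 * 1"
        using elim unfolding abs_mult by (intro mult_mono) auto
      then show "\<bar>m r \<alpha>\<bar> \<le> 2"
        using \<alpha> elim by (simp add: m_initial)
    qed
  qed
  then show ?case by auto
next
  case (Suc n)
  then obtain B where B: "\<forall>\<^sub>F r in at_right 0. \<forall>\<alpha>\<in>{1..2 + real n}. \<bar>m r \<alpha>\<bar> \<le> B" by blast
  \<comment> \<open>The boundary term contributes \<open>2 * B\<close>, since
    \<open>2 powr (1 - r)\<close> is at most 2; the integral runs over a length of at most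
    \<open>Suc n\<close>.\<close>
  have "\<forall>\<^sub>F r in at_right 0. \<forall>\<alpha>\<in>{1..2 + real (Suc n)}. \<bar>m r \<alpha>\<bar> \<le> 2 * B + B * real (Suc n)"
    using B eventually_at_right_0_unit
  proof eventually_elim
    case (elim r)
    have B0: "0 \<le> B" using elim(1) by (force dest: bspec[of _ _ 1])
    show ?case
    proof
      fix \<alpha> :: real assume \<alpha>: "\<alpha> \<in> {1..2 + real (Suc n)}"
      show "\<bar>m r \<alpha>\<bar> \<le> 2 * B + B * real (Suc n)"
      proof (cases "\<alpha> \<le> 2")
        case True
        then have "\<bar>m r \<alpha>\<bar> \<le> B" using elim(1) \<alpha> by auto
        moreover have "0 \<le> B * real (Suc n)" using B0 by simp
        ultimately show ?thesis using B0 by linarith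
      next
        case False
        let ?I = "integral {2..\<alpha>} (\<lambda>u. m r (u - 1) / u powr r)"
        have "norm ?I \<le> integral {2..\<alpha>} (\<lambda>u. B)"
        proof (rule integral_norm_bound_integral)
          fix u assume "u \<in> {2..\<alpha>}"
          then show "norm (m r (u - 1) / u powr r) \<le> B"
            unfolding real_norm_def using elim \<alpha> by (intro abs_divide_powr_le) auto
        qed (use m_integrand_integrable elim in auto)
        also have "\<dots> = B * (\<alpha> - 2)" using False by simp
        also have "\<dots> \<le> B * real (Suc n)" using B0 \<alpha> by (intro mult_left_mono) auto
        finally have I: "\<bar>?I\<bar> \<le> B * real (Suc n)" by simp
        have p: "\<alpha> powr (r - 1) \<le> 1" using False elim powr_mono2'[of "r - 1" 1 \<alpha>] by auto
        have q: "2 powr (1 - r) \<le> (2::real)" using elim powr_mono[of "1 - r" 1 "2::real"] by simp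
        have m2: "\<bar>m r 2\<bar> \<le> B" using elim(1) by auto
        have "\<bar>2 powr (1 - r) * m r 2 * \<alpha> powr (r - 1)\<bar> \<le> 2 * B * 1"
          unfolding abs_mult using p q m2 B0 by (intro mult_mono) auto
        moreover have "\<bar>(1 - r) * \<alpha> powr (r - 1) * ?I\<bar> \<le> 1 * 1 * (B * real (Suc n))"
          unfolding abs_mult using p elim I B0 by (intro mult_mono) auto
        ultimately show ?thesis
          using False m_recursion[of \<alpha> r] by linarith
      qed
    qed
  qed
  then show ?case by blast
qed

section \<open>Passage to the limit\<close>

lemma m_tendsto_initial:
  assumes "1 < \<alpha>" "\<alpha> \<le> 2"
  shows "((\<lambda>r. m r \<alpha>) \<longlongrightarrow> 1 / \<alpha>) (at_right 0)"
proof -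
  have J: "((\<lambda>r. r * integral {1..\<alpha>} (kernel r)) \<longlongrightarrow> 1) (at_right 0)"
  proof (rule tendsto_sandwich)
    show "((\<lambda>r. \<alpha> powr (-r) * (\<alpha> - 1) powr r) \<longlongrightarrow> 1) (at_right 0)"
      "((\<lambda>r. (\<alpha> - 1) powr r) \<longlongrightarrow> 1) (at_right 0)"
      using assms by (auto intro!: tendsto_eq_intros)
    show "\<forall>\<^sub>F r in at_right 0. \<alpha> powr (-r) * (\<alpha> - 1) powr r \<le> r * integral {1..\<alpha>} (kernel r)"
      "\<forall>\<^sub>F r in at_right 0. r * integral {1..\<alpha>} (kernel r) \<le> (\<alpha> - 1) powr r"
      using eventually_at_right_0_unit
      by (eventually_elim, use kernel_integral_bounds assms in auto)+
  qed
  have "((\<lambda>r. g1 r / Gamma (1 + r) *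
           (\<alpha> powr (r - 1) * (r + (1 - r) * (r * integral {1..\<alpha>} (kernel r)))))
         \<longlongrightarrow> 1 * (\<alpha> powr (0 - 1) * (0 + (1 - 0) * 1))) (at_right 0)"
    using assms by (intro tendsto_intros g1_div_Gamma_plus1_tendsto_1 J) auto
  then have "((\<lambda>r. g1 r / Gamma (1 + r) *
           (\<alpha> powr (r - 1) * (r + (1 - r) * (r * integral {1..\<alpha>} (kernel r)))))
         \<longlongrightarrow> 1 / \<alpha>) (at_right 0)"
    using assms by (simp add: powr_minus_divide)
  then show ?thesis
    by (rule Lim_transform_eventually)
      (use eventually_at_right_0_unit in eventually_elim, use assms in \<open>simp add: m_initial\<close>)
qed

text \<open>Setting \<open>r = 0\<close> formally in the recursion of \<open>m\<close> gives the
  integral equation of \<open>bfun\<close>; the induction on unit intervals justifies this.\<close>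

lemma m_tendsto_bfun:
  assumes "1 < \<alpha>" "\<alpha> \<le> 2 + real n"
  shows "((\<lambda>r. m r \<alpha>) \<longlongrightarrow> bfun \<alpha>) (at_right 0)"
  using assms
proof (induction n arbitrary: \<alpha>)
  case 0
  then show ?case using m_tendsto_initial[of \<alpha>] by (simp add: bfun.simps[of \<alpha>])
next
  case (Suc n)
  show ?case
  proof (cases "\<alpha> \<le> 2")
    case True
    then show ?thesis using m_tendsto_initial[of \<alpha>] Suc.prems by (simp add: bfun.simps[of \<alpha>])
  next
    case False
    obtain B where B: "\<forall>\<^sub>F r in at_right 0. \<forall>\<alpha>\<in>{1..2 + real n}. \<bar>m r \<alpha>\<bar> \<le> B"
      using m_eventually_bounded by blast
    \<comment> \<open>For \<open>u > 2\<close> the argument \<open>u - 1\<close> exceeds 1 and the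
      induction hypothesis applies. At \<open>u = 2\<close> pointwise convergence fails:
      \<open>m r 1\<close> tends to 0, whereas \<open>bfun 1 = 1\<close>.\<close>
    have "((\<lambda>r. integral {2<..<\<alpha>} (\<lambda>u. m r (u - 1) / u powr r)) \<longlongrightarrow>
             integral {2<..<\<alpha>} (\<lambda>u. bfun (u - 1))) (at_right 0)"
    proof (rule dominated_convergence_at_within[where h = "\<lambda>_. B"])
      show "\<forall>\<^sub>F r in at_right 0. (\<lambda>u. m r (u - 1) / u powr r) integrable_on {2<..<\<alpha>} \<and>
              (\<forall>u\<in>{2<..<\<alpha>}. norm (m r (u - 1) / u powr r) \<le> B)"
        using B eventually_at_right_0_unit
      proof eventually_elim
        case (elim r)
        then show ?case
          using Suc.prems
          by (auto simp: integrable_on_open_interval_real m_integrand_integrable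
              simp del: abs_divide intro!: abs_divide_powr_le)
      qed
      show "(\<lambda>_. B) integrable_on {2<..<\<alpha>}"
        by (simp add: integrable_on_open_interval_real integrable_const_ivl)
      show "((\<lambda>r. m r (u - 1) / u powr r) \<longlongrightarrow> bfun (u - 1)) (at_right 0)" if "u \<in> {2<..<\<alpha>}" for u
      proof -
        have "((\<lambda>r. m r (u - 1) / u powr r) \<longlongrightarrow> bfun (u - 1) / u powr 0) (at_right 0)"
          using that Suc.prems by (intro tendsto_intros Suc.IH) auto
        then show ?thesis using that by simp
      qed
    qed
    then have I: "((\<lambda>r. integral {2..\<alpha>} (\<lambda>u. m r (u - 1) / u powr r)) \<longlongrightarrow>
             integral {2..\<alpha>} (\<lambda>u. bfun (u - 1))) (at_right 0)"
      by (simp add: integral_open_interval_real)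
    \<comment> \<open>The limit \<open>1 / 2\<close> of \<open>m r 2\<close> cancels against
      \<open>2 powr 1\<close>, leaving the constant 1 of \<open>bfun_eq\<close>.\<close>
    have "((\<lambda>r. 2 powr (1 - r) * m r 2 * \<alpha> powr (r - 1) +
           (1 - r) * \<alpha> powr (r - 1) * integral {2..\<alpha>} (\<lambda>u. m r (u - 1) / u powr r)) \<longlongrightarrow>
          2 powr (1 - 0) * (1 / 2) * \<alpha> powr (0 - 1) +
           (1 - 0) * \<alpha> powr (0 - 1) * integral {2..\<alpha>} (\<lambda>u. bfun (u - 1))) (at_right 0)"
      using False by (intro tendsto_intros I m_tendsto_initial) auto
    then show ?thesis
      using False by (simp add: m_recursion[symmetric] bfun_eq powr_minus_divide add_divide_distrib)
  qed
qed

theorem theorem8: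
  fixes \<alpha> :: real
  assumes "\<alpha> > 1"
  shows "((\<lambda>r. m r \<alpha>) \<longlongrightarrow> buchstab \<alpha>) (at_right 0)"
proof -
  obtain n where "\<alpha> \<le> real n" using real_arch_simple by blast
  then have "((\<lambda>r. m r \<alpha>) \<longlongrightarrow> bfun \<alpha>) (at_right 0)"
    using assms by (intro m_tendsto_bfun[of _ n]) auto
  moreover have "buchstab = bfun"
    by (rule is_buchstab_unique[OF is_buchstab_buchstab is_buchstab_bfun])
  ultimately show ?thesis by simp
qed

end
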